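(* Let $\rho>0$ and consider the dynamical system on $(x,\lambda,\nu)\in\mathbb R\times\mathbb R\times\mathbb R$ $$\dot x(t)=-x(t)-\nu(t)-[\rho(x(t)-1)+\lambda(t)]_+,\qquad \dot\lambda(t)=\frac1\rho\left([\rho(x(t)-1)+\lambda(t)]_+-\lambda(t)\right),\qquad \dot\nu(t)=x(t).$$ The equilibrium point $z^\ast=(0,0,0)$ of this system is not globally exponentially stable. In other words, there do not exist $M>0$ and $\xi>0$ such that for any initial point $z(0)=(x(0),\lambda(0),\nu(0))\in\mathbb R\times[0,+\infty)\times\mathbb R$, the solution $z(t)=(x(t),\lambda(t),\nu(t))$ satisfies $$\|z(t)-z^\ast\|\le M e^{-\xi t}\|z(0)-z^\ast\|\qquad\text{for all } t\ge 0 .$$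
   Context: Notation: $[u]_+=\max\{u,0\}$ and $\|\cdot\|$ is the Euclidean norm. The system is the augmented primal-dual gradient dynamics (Aug-PDGD) with parameter $\rho>0$ associated with the strongly convex quadratic program $\min_{x\in\mathbb R}\frac12x^2$ subject to $x\le 1$ and $x=0$, whose unique KKT point is $(x^\ast,\lambda^\ast,\nu^\ast)=(0,0,0)$ ($\lambda$ is the multiplier of $x\le1$, $\nu$ that of $x=0$). *)

theory Defs
  imports "HOL-Analysis.Analysis"
begin

definition pos_part :: "real \<Rightarrow> real" where
  "pos_part u = max u 0"

(* States are triples (x, lambda, nu).  The library norm on real * real * real is
   sqrt (x^2 + lambda^2 + nu^2), i.e. the Euclidean norm. *)
definition aug_pdgd :: "real \<Rightarrow> real \<times> real \<times> real \<Rightarrow> real \<times> real \<times> real" where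
  "aug_pdgd \<rho> = (\<lambda>(x, lam, nu).
     (- x - nu - pos_part (\<rho> * (x - 1) + lam),
      (1 / \<rho>) * (pos_part (\<rho> * (x - 1) + lam) - lam),
      x))"

(* At t = 0 the derivative is one-sided; values of z at negative times are irrelevant. *)
definition forward_solution ::
  "('a::real_normed_vector \<Rightarrow> 'a) \<Rightarrow> (real \<Rightarrow> 'a) \<Rightarrow> bool" where
  "forward_solution f z \<longleftrightarrow>
     (\<forall>t\<ge>0. (z has_vector_derivative f (z t)) (at t within {0..}))"

definition equilibrium :: "('a::real_normed_vector \<Rightarrow> 'a) \<Rightarrow> 'a \<Rightarrow> bool" where
  "equilibrium f p \<longleftrightarrow> f p = 0"

(* S is the set of admissible initial points.  The bound is required of every forward
   solution starting in S; existence of solutions is not part of the definition, so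
   refuting it requires an actual solution that violates the bound. *)
definition globally_exp_stable ::
  "('a::real_normed_vector \<Rightarrow> 'a) \<Rightarrow> 'a set \<Rightarrow> 'a \<Rightarrow> bool" where
  "globally_exp_stable f S p \<longleftrightarrow>
     (\<exists>M>0. \<exists>\<xi>>0. \<forall>z. forward_solution f z \<and> z 0 \<in> S \<longrightarrow>
        (\<forall>t\<ge>0. norm (z t - p) \<le> M * exp (- \<xi> * t) * norm (z 0 - p)))"

end

theory Submission
  imports Defs "HOL-Real_Asymp.Real_Asymp"
begin

text \<open>
  Where \<open>\<rho> * (x - 1) + \<lambda> \<ge> 0\<close> the positive part is the identity, and \<open>x'\<close> depends on the
  multipliers through \<open>\<lambda> + \<nu>\<close> only.  Their derivatives \<open>x - 1\<close> and \<open>x\<close> cancel at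
  \<open>x = 1/2\<close>, and \<open>\<lambda> + \<nu> = (\<rho> - 1) / 2\<close> makes \<open>x' = 0\<close>.  So \<open>x\<close> can stay at \<open>1/2\<close>
  while \<open>\<lambda>\<close> decreases and \<open>\<nu>\<close> increases at the constant speed \<open>1/2\<close>: the state moves
  along a straight line.  Coming from distance of order \<open>T\<close>, it needs time of order \<open>T\<close> to
  come near the origin, and a bound of order \<open>exp (- \<xi> * T) * T\<close> fails for large \<open>T\<close>.

  The line meets the switching surface at \<open>(1/2, \<rho>/2, -1/2)\<close>, and from there the orbit
  has to be continued to all later times.  On the other side of the surface \<open>x\<close> is a damped
  oscillator \<open>x'' + x' + x = 0\<close> released at rest from \<open>1/2\<close> and \<open>\<lambda>\<close> decays
  exponentially.  Since \<open>x \<le> 1/2\<close> and \<open>\<lambda> \<le> \<rho>/2\<close> persist, the orbit never crosses the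
  surface again.  The two pieces therefore form one explicit solution on the whole real line
  (\<open>orbit_solves\<close>).  Its time shifts are forward solutions that start at ever more remote
  points of the orbit and all pass through the same nonzero point, which refutes exponential
  stability (\<open>not_globally_exp_stable_if_slow_orbit\<close>).
\<close>

section \<open>Entire orbits with subexponential backward growth\<close>

text \<open>
  The solution that starts at \<open>y (- T)\<close> is at \<open>y 0\<close> after time \<open>T\<close>.  An exponential bound
  thus limits the fixed positive number \<open>norm (y 0 - p)\<close> by a quantity tending to \<open>0\<close>.
\<close>

lemma not_globally_exp_stable_if_slow_orbit:
  fixes f :: "'a::real_normed_vector \<Rightarrow> 'a"
  assumes sol: "\<And>t. (y has_vector_derivative f (y t)) (at t)"
    and start: "\<And>T. T \<ge> 0 \<Longrightarrow> y (- T) \<in> S"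
    and slow: "\<And>\<xi>. \<xi> > 0 \<Longrightarrow> ((\<lambda>T. exp (- \<xi> * T) * norm (y (- T) - p)) \<longlongrightarrow> 0) at_top"
    and off: "y 0 \<noteq> p"
  shows "\<not> globally_exp_stable f S p"
proof
  assume "globally_exp_stable f S p"
  then obtain M \<xi> where "\<xi> > 0"
    and bound: "\<And>z t. forward_solution f z \<Longrightarrow> z 0 \<in> S \<Longrightarrow> t \<ge> 0 \<Longrightarrow>
      norm (z t - p) \<le> M * exp (- \<xi> * t) * norm (z 0 - p)"
    unfolding globally_exp_stable_def by blast
  have shifted: "forward_solution f (\<lambda>t. y (t - T))" for T
    unfolding forward_solution_def
  proof (intro allI impI)
    fix t :: real
    have "((\<lambda>t. t - T) has_vector_derivative 1) (at t)"
      by (auto intro!: derivative_eq_intros)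
    from vector_diff_chain_at[OF this sol]
    show "((\<lambda>t. y (t - T)) has_vector_derivative f (y (t - T))) (at t within {0..})"
      by (simp add: o_def has_vector_derivative_at_within)
  qed
  have "norm (y 0 - p) \<le> M * (exp (- \<xi> * T) * norm (y (- T) - p))" if "T \<ge> 0" for T
    using bound[OF shifted[of T], of T] start[OF that] that by (simp add: mult.assoc)
  then have "\<forall>\<^sub>F T in at_top. norm (y 0 - p) \<le> M * (exp (- \<xi> * T) * norm (y (- T) - p))"
    by (rule eventually_at_top_linorderI)
  moreover have "((\<lambda>T. M * (exp (- \<xi> * T) * norm (y (- T) - p))) \<longlongrightarrow> 0) at_top"
    by (rule tendsto_mult_right_zero[OF slow[OF \<open>\<xi> > 0\<close>]])
  ultimately have "norm (y 0 - p) \<le> 0"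
    using tendsto_lowerbound trivial_limit_at_top_linorder by blast
  with off show False by simp
qed

section \<open>The two pieces of the orbit\<close>

definition incoming_line :: "real \<Rightarrow> real \<Rightarrow> real \<times> real \<times> real" where
  "incoming_line \<rho> t = (1/2, \<rho>/2 - t/2, -1/2 + t/2)"

text \<open>
  The solution of \<open>x' = - x - \<nu>\<close>, \<open>\<nu>' = x\<close> with \<open>x 0 = 1/2\<close> and \<open>\<nu> 0 = - 1/2\<close>, the end
  point of the line.  Eliminating \<open>\<nu>\<close> gives \<open>x'' + x' + x = 0\<close>, with characteristic roots
  \<open>- 1/2 \<plusminus> \<i> * sqrt 3/2\<close>.
\<close>

definition oscillator_x :: "real \<Rightarrow> real" where
  "oscillator_x t = exp (- t/2) * (cos (sqrt 3/2 * t) + sin (sqrt 3/2 * t) / sqrt 3) / 2"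

definition oscillator_nu :: "real \<Rightarrow> real" where
  "oscillator_nu t = - exp (- t/2) * (cos (sqrt 3/2 * t) - sin (sqrt 3/2 * t) / sqrt 3) / 2"

definition outgoing_spiral :: "real \<Rightarrow> real \<Rightarrow> real \<times> real \<times> real" where
  "outgoing_spiral \<rho> t = (oscillator_x t, \<rho>/2 * exp (- t/\<rho>), oscillator_nu t)"

lemma incoming_line_solves:
  assumes "\<rho> > 0" "t \<le> 0"
  shows "(incoming_line \<rho> has_vector_derivative aug_pdgd \<rho> (incoming_line \<rho> t)) (at t)"
proof -
  have "aug_pdgd \<rho> (incoming_line \<rho> t) = (0, - 1/2, 1/2)"
    using assms by (simp add: aug_pdgd_def incoming_line_def pos_part_def field_simps)
  moreover have "(incoming_line \<rho> has_vector_derivative (0, - 1/2, 1/2)) (at t)"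
    unfolding incoming_line_def
    by (intro has_vector_derivative_Pair;
        auto intro!: derivative_eq_intros simp flip: has_real_derivative_iff_has_vector_derivative)
  ultimately show ?thesis by simp
qed

text \<open>
  With \<open>\<theta> = sqrt 3/2 * t\<close>, the claim is \<open>cos \<theta> + sin \<theta> / sqrt 3 \<le> exp (t/2)\<close>, which
  follows from \<open>cos \<theta> \<le> 1\<close>, \<open>sin \<theta> \<le> \<theta>\<close> and \<open>1 + t/2 \<le> exp (t/2)\<close>.
\<close>

lemma oscillator_x_le_half:
  assumes "t \<ge> 0"
  shows "oscillator_x t \<le> 1/2"
proof -
  have "sin (sqrt 3/2 * t) / sqrt 3 \<le> (sqrt 3/2 * t) / sqrt 3"
    using assms by (intro divide_right_mono sin_x_le_x) auto
  also have "\<dots> = t/2" by simp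
  finally have "cos (sqrt 3/2 * t) + sin (sqrt 3/2 * t) / sqrt 3 \<le> 1 + t/2"
    using cos_le_one[of "sqrt 3/2 * t"] by linarith
  also have "\<dots> \<le> exp (t/2)"
    by (rule exp_ge_add_one_self)
  finally have "exp (- t/2) * (cos (sqrt 3/2 * t) + sin (sqrt 3/2 * t) / sqrt 3)
      \<le> exp (- t/2) * exp (t/2)"
    by (intro mult_left_mono) auto
  then show ?thesis
    by (simp add: oscillator_x_def flip: exp_add)
qed

lemma oscillator_x_deriv:
  "(oscillator_x has_real_derivative - oscillator_x t - oscillator_nu t) (at t)"
proof -
  have sqrt3: "sqrt 3 * (sqrt 3 * u) = 3 * u" for u :: real
    by (simp flip: mult.assoc)
  show ?thesis
    unfolding oscillator_x_def oscillator_nu_def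
    by (auto intro!: derivative_eq_intros simp: field_simps sqrt3)
qed

lemma oscillator_nu_deriv:
  "(oscillator_nu has_real_derivative oscillator_x t) (at t)"
proof -
  have sqrt3: "sqrt 3 * (sqrt 3 * u) = 3 * u" for u :: real
    by (simp flip: mult.assoc)
  show ?thesis
    unfolding oscillator_x_def oscillator_nu_def
    by (auto intro!: derivative_eq_intros simp: field_simps sqrt3)
qed

text \<open>
  On this piece the multiplier satisfies \<open>\<lambda> \<le> \<rho>/2\<close>, so \<open>x \<le> 1/2\<close> keeps
  \<open>\<rho> * (x - 1) + \<lambda>\<close> nonpositive.
\<close>

lemma outgoing_spiral_solves:
  assumes "\<rho> > 0" "t \<ge> 0"
  shows "(outgoing_spiral \<rho> has_vector_derivative aug_pdgd \<rho> (outgoing_spiral \<rho> t)) (at t)"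
proof -
  have "\<rho> * (oscillator_x t - 1) \<le> \<rho> * (- 1/2)"
    using oscillator_x_le_half[OF assms(2)] assms(1) by (intro mult_left_mono) auto
  moreover have "\<rho>/2 * exp (- t/\<rho>) \<le> \<rho>/2 * 1"
    using assms by (intro mult_left_mono) auto
  ultimately have "pos_part (\<rho> * (oscillator_x t - 1) + \<rho>/2 * exp (- t/\<rho>)) = 0"
    by (simp add: pos_part_def)
  then have "aug_pdgd \<rho> (outgoing_spiral \<rho> t) =
      (- oscillator_x t - oscillator_nu t, - exp (- t/\<rho>) / 2, oscillator_x t)"
    using assms by (simp add: aug_pdgd_def outgoing_spiral_def)
  moreover have "((\<lambda>t. \<rho>/2 * exp (- t/\<rho>)) has_real_derivative - exp (- t/\<rho>) / 2) (at t)"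
    using assms by (auto intro!: derivative_eq_intros)
  ultimately show ?thesis
    unfolding outgoing_spiral_def
    using oscillator_x_deriv[of t] oscillator_nu_deriv[of t]
    by (simp add: has_vector_derivative_Pair has_real_derivative_iff_has_vector_derivative)
qed

section \<open>The entire orbit\<close>

definition orbit :: "real \<Rightarrow> real \<Rightarrow> real \<times> real \<times> real" where
  "orbit \<rho> t = (if t \<le> 0 then incoming_line \<rho> t else outgoing_spiral \<rho> t)"

lemma orbit_solves:
  assumes "\<rho> > 0"
  shows "(orbit \<rho> has_vector_derivative aug_pdgd \<rho> (orbit \<rho> t)) (at t)"
proof -
  have junction: "incoming_line \<rho> 0 = outgoing_spiral \<rho> 0"
    by (simp add: incoming_line_def outgoing_spiral_def oscillator_x_def oscillator_nu_def)
  have "((\<lambda>t. if t \<in> {..0} then incoming_line \<rho> t else outgoing_spiral \<rho> t)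
      has_vector_derivative
      (if t \<in> {..0} then aug_pdgd \<rho> (incoming_line \<rho> t) else aug_pdgd \<rho> (outgoing_spiral \<rho> t)))
      (at t within UNIV)"
    by (rule has_vector_derivative_If_within_closures[where x = t and S = "{..0}" and T = "{0<..}"
          and f = "incoming_line \<rho>" and f' = "\<lambda>t. aug_pdgd \<rho> (incoming_line \<rho> t)"
          and g = "outgoing_spiral \<rho>" and g' = "\<lambda>t. aug_pdgd \<rho> (outgoing_spiral \<rho> t)"])
      (use junction in \<open>auto intro:
        has_vector_derivative_at_within[OF incoming_line_solves[OF assms]]
        has_vector_derivative_at_within[OF outgoing_spiral_solves[OF assms]]\<close>)
  then show ?thesis
    by (cases "t \<le> 0") (simp_all add: orbit_def[abs_def])
qed

text \<open>The distance to the origin grows only linearly backwards in time.\<close>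

lemma incoming_line_slow:
  assumes "\<xi> > 0"
  shows "((\<lambda>T. exp (- \<xi> * T) * norm (incoming_line \<rho> (- T))) \<longlongrightarrow> 0) at_top"
proof -
  define a b :: "real \<times> real \<times> real" where "a = incoming_line \<rho> 0" and "b = (0, 1/2, - 1/2)"
  have line: "incoming_line \<rho> (- T) = a + T *\<^sub>R b" for T
    by (simp add: incoming_line_def a_def b_def)
  have "norm (incoming_line \<rho> (- T)) \<le> norm a + T * norm b" if "T \<ge> 0" for T
    using norm_triangle_ineq[of a "T *\<^sub>R b"] that by (simp add: line)
  then have "\<forall>\<^sub>F T in at_top. norm (exp (- \<xi> * T) * norm (incoming_line \<rho> (- T)))
      \<le> exp (- \<xi> * T) * (norm a + T * norm b)"
    by (intro eventually_at_top_linorderI[of 0]) (simp add: abs_mult)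
  moreover have "((\<lambda>T. exp (- \<xi> * T) * (norm a + T * norm b)) \<longlongrightarrow> 0) at_top"
    using assms by real_asymp
  ultimately show ?thesis
    by (rule Lim_null_comparison)
qed

theorem proposition2:
  fixes \<rho> :: real
  assumes "\<rho> > 0"
  shows "equilibrium (aug_pdgd \<rho>) (0, 0, 0) \<and>
    \<not> globally_exp_stable (aug_pdgd \<rho>) (UNIV \<times> {0..} \<times> UNIV) (0, 0, 0)"
proof
  show "equilibrium (aug_pdgd \<rho>) (0, 0, 0)"
    using assms by (simp add: equilibrium_def aug_pdgd_def pos_part_def zero_prod_def)
  show "\<not> globally_exp_stable (aug_pdgd \<rho>) (UNIV \<times> {0..} \<times> UNIV) (0, 0, 0)"
  proof (rule not_globally_exp_stable_if_slow_orbit[OF orbit_solves[OF assms]])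
    show "orbit \<rho> (- T) \<in> UNIV \<times> {0..} \<times> UNIV" if "T \<ge> 0" for T
      using that assms by (simp add: orbit_def incoming_line_def)
    show "orbit \<rho> 0 \<noteq> (0, 0, 0)"
      by (simp add: orbit_def incoming_line_def)
    show "((\<lambda>T. exp (- \<xi> * T) * norm (orbit \<rho> (- T) - (0, 0, 0))) \<longlongrightarrow> 0) at_top"
      if "\<xi> > 0" for \<xi>
    proof (rule Lim_transform_eventually[OF incoming_line_slow[OF that, of \<rho>]])
      show "\<forall>\<^sub>F T in at_top. exp (- \<xi> * T) * norm (incoming_line \<rho> (- T)) =
          exp (- \<xi> * T) * norm (orbit \<rho> (- T) - (0, 0, 0))"
        by (rule eventually_at_top_linorderI[of 0]) (simp add: orbit_def flip: zero_prod_def)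
    qed
  qed
qed

end
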